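(* There exists a universal constant $C>0$ such that for every $n\ge 1$ and every function $f:\{-1,1\}^n\to\mathbb{R}$ with $\deg(f)=d$, we have $$\mathrm{Inf}(f)\le C\, d^3\, \|f\|_\infty .$$
   Context: The cube $\{-1,1\}^n$ carries the uniform probability measure; $\mathbb{E}_x$ is expectation under it, $\|g\|_1=\mathbb{E}_x|g(x)|$ and $\|g\|_\infty=\max_x|g(x)|$. Every $f:\{-1,1\}^n\to\mathbb{R}$ has a unique expansion $f=\sum_{S\subseteq[n]}\hat f(S)\chi_S$ with $\chi_S(x)=\prod_{i\in S}x_i$, and $\deg(f)=\max\{|S|:\hat f(S)\ne 0\}$ (take $\deg(0)=0$). For $i\in[n]=\{1,\dots,n\}$ let $x^i$ be $x$ with the $i$-th coordinate negated, and $\partial_i f(x)=(f(x)-f(x^i))/2=\sum_{S\ni i}\hat f(S)\chi_S(x)$. The $i$-th $L_1$ influence is $\mathrm{Inf}_i(f)=\|\partial_i f\|_1$ and the total $L_1$ influence is $\mathrm{Inf}(f)=\sum_{i=1}^n\|\partial_i f\|_1$. *)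

theory Defs
  imports "HOL-Probability.Probability"
begin

text \<open>
  The dimension \<open>n\<close> is quantified after the universal constant, so it is a natural number and
  not a type: a point of the cube is an extensional function on \<open>{1..n}\<close>.  A function
  \<open>f :: (nat \<Rightarrow> real) \<Rightarrow> real\<close> stands for its restriction to \<open>cube n\<close>; the degree,
  norms and influences below do not depend on its values elsewhere (see \<open>flip_in_cube\<close>).
\<close>

definition cube :: "nat \<Rightarrow> (nat \<Rightarrow> real) set" where
  "cube n = {1..n} \<rightarrow>\<^sub>E {-1, 1}"

definition cube_expectation :: "nat \<Rightarrow> ((nat \<Rightarrow> real) \<Rightarrow> real) \<Rightarrow> real" where
  "cube_expectation n g = measure_pmf.expectation (pmf_of_set (cube n)) g"

definition L1_norm :: "nat \<Rightarrow> ((nat \<Rightarrow> real) \<Rightarrow> real) \<Rightarrow> real" where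
  "L1_norm n g = cube_expectation n (\<lambda>x. \<bar>g x\<bar>)"

definition sup_norm :: "nat \<Rightarrow> ((nat \<Rightarrow> real) \<Rightarrow> real) \<Rightarrow> real" where
  "sup_norm n g = Max ((\<lambda>x. \<bar>g x\<bar>) ` cube n)"

definition walsh :: "nat set \<Rightarrow> (nat \<Rightarrow> real) \<Rightarrow> real" where
  "walsh S x = (\<Prod>i\<in>S. x i)"

definition is_fourier_expansion ::
  "nat \<Rightarrow> ((nat \<Rightarrow> real) \<Rightarrow> real) \<Rightarrow> (nat set \<Rightarrow> real) \<Rightarrow> bool" where
  "is_fourier_expansion n f c \<longleftrightarrow>
     (\<forall>x\<in>cube n. f x = (\<Sum>S\<in>Pow {1..n}. c S * walsh S x)) \<and>
     (\<forall>S. \<not> S \<subseteq> {1..n} \<longrightarrow> c S = 0)"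

text \<open>
  Existence and uniqueness of the expansion are proved below (\<open>fourier_expansion_ex1\<close>); the
  second clause of \<open>is_fourier_expansion\<close> only normalizes \<open>c\<close> off the subsets of \<open>{1..n}\<close>.
\<close>

definition fourier_coeff :: "nat \<Rightarrow> ((nat \<Rightarrow> real) \<Rightarrow> real) \<Rightarrow> nat set \<Rightarrow> real" where
  "fourier_coeff n f = (THE c. is_fourier_expansion n f c)"

text \<open>The inserted \<open>0\<close> only matters when all coefficients vanish: it gives \<open>deg(0) = 0\<close>.\<close>

definition fourier_degree :: "nat \<Rightarrow> ((nat \<Rightarrow> real) \<Rightarrow> real) \<Rightarrow> nat" where
  "fourier_degree n f = Max (insert 0 (card ` {S. S \<subseteq> {1..n} \<and> fourier_coeff n f S \<noteq> 0}))"

definition flip :: "nat \<Rightarrow> (nat \<Rightarrow> real) \<Rightarrow> (nat \<Rightarrow> real)" where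
  "flip i x = x(i := - x i)"

definition discrete_deriv :: "nat \<Rightarrow> ((nat \<Rightarrow> real) \<Rightarrow> real) \<Rightarrow> (nat \<Rightarrow> real) \<Rightarrow> real" where
  "discrete_deriv i f x = (f x - f (flip i x)) / 2"

definition L1_influence :: "nat \<Rightarrow> nat \<Rightarrow> ((nat \<Rightarrow> real) \<Rightarrow> real) \<Rightarrow> real" where
  "L1_influence n i f = L1_norm n (discrete_deriv i f)"

definition total_L1_influence :: "nat \<Rightarrow> ((nat \<Rightarrow> real) \<Rightarrow> real) \<Rightarrow> real" where
  "total_L1_influence n f = (\<Sum>i = 1..n. L1_influence n i f)"

lemma finite_cube: "finite (cube n)"
  by (simp add: cube_def finite_PiE)

lemma card_cube: "card (cube n) = 2 ^ n"
  by (simp add: cube_def card_PiE numeral_2_eq_2)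

lemma cube_nonempty: "cube n \<noteq> {}"
  using card_cube[of n] by auto

lemma cube_expectation_eq: "cube_expectation n g = (\<Sum>x\<in>cube n. g x) / 2 ^ n"
  by (simp add: cube_expectation_def integral_pmf_of_set finite_cube cube_nonempty card_cube)

lemma flip_in_cube: "x \<in> cube n \<Longrightarrow> i \<in> {1..n} \<Longrightarrow> flip i x \<in> cube n"
  by (auto simp: cube_def flip_def PiE_iff extensional_def)

lemma walsh_orthogonal:
  assumes "S \<subseteq> {1..n}" "T \<subseteq> {1..n}"
  shows "(\<Sum>x\<in>cube n. walsh S x * walsh T x) = (if S = T then 2 ^ n else 0)"
proof -
  define h :: "nat \<Rightarrow> real \<Rightarrow> real"
    where "h i v = (if i \<in> S then v else 1) * (if i \<in> T then v else 1)" for i v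
  have "walsh S x * walsh T x = (\<Prod>i\<in>{1..n}. h i (x i))" for x
  proof -
    have "{1..n} \<inter> S = S" "{1..n} \<inter> T = T" using assms by auto
    then show ?thesis
      by (simp add: walsh_def h_def prod.distrib prod.If_cases flip: prod.inter_restrict)
  qed
  then have "(\<Sum>x\<in>cube n. walsh S x * walsh T x) = (\<Prod>i\<in>{1..n}. \<Sum>v\<in>{-1, 1}. h i v)"
    unfolding cube_def by (subst prod_sum_PiE) auto
  also have "\<dots> = (\<Prod>i\<in>{1..n}. if i \<in> S \<longleftrightarrow> i \<in> T then 2 else 0)"
    by (intro prod.cong) (auto simp: h_def)
  also have "\<dots> = (if S = T then 2 ^ n else 0)"
  proof (cases "S = T")
    case False
    then obtain i where "i \<in> {1..n}" "(i \<in> S) \<noteq> (i \<in> T)" using assms by blast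
    then show ?thesis using False by (auto intro!: prod_zero)
  qed simp
  finally show ?thesis .
qed

lemma walsh_completeness:
  assumes "x \<in> cube n" "y \<in> cube n"
  shows "(\<Sum>S\<in>Pow {1..n}. walsh S x * walsh S y) = (if x = y then 2 ^ n else 0)"
proof -
  have "(\<Sum>S\<in>Pow {1..n}. walsh S x * walsh S y) = (\<Prod>i\<in>{1..n}. x i * y i + 1)"
    by (simp add: prod_add walsh_def prod.distrib)
  also have "\<dots> = (if x = y then 2 ^ n else 0)"
  proof (cases "x = y")
    case True
    have "x i * y i + 1 = 2" if "i \<in> {1..n}" for i
      using that assms True PiE_mem[of y "{1..n}" "\<lambda>_. {-1, 1}" i] by (auto simp: cube_def)
    then show ?thesis using True by simp
  next
    case False
    then obtain i where i: "i \<in> {1..n}" "x i \<noteq> y i"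
      using assms by (metis PiE_ext cube_def)
    then have "x i \<in> {-1, 1}" "y i \<in> {-1, 1}"
      using assms unfolding cube_def by blast+
    then have "x i * y i + 1 = 0" using i by auto
    then show ?thesis using False i by (auto intro!: prod_zero)
  qed
  finally show ?thesis .
qed

lemma is_fourier_expansion_iff:
  "is_fourier_expansion n f c \<longleftrightarrow>
     c = (\<lambda>S. if S \<subseteq> {1..n} then cube_expectation n (\<lambda>x. f x * walsh S x) else 0)"
  (is "_ \<longleftrightarrow> c = ?c")
proof
  assume c: "is_fourier_expansion n f c"
  show "c = ?c"
  proof
    fix T
    show "c T = ?c T"
    proof (cases "T \<subseteq> {1..n}")
      case True
      have "(\<Sum>x\<in>cube n. f x * walsh T x)
          = (\<Sum>x\<in>cube n. \<Sum>S\<in>Pow {1..n}. c S * (walsh S x * walsh T x))"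
        using c by (intro sum.cong) (auto simp: is_fourier_expansion_def sum_distrib_right mult.assoc)
      also have "\<dots> = (\<Sum>S\<in>Pow {1..n}. c S * (\<Sum>x\<in>cube n. walsh S x * walsh T x))"
        by (subst sum.swap) (simp add: sum_distrib_left)
      also have "\<dots> = (\<Sum>S\<in>Pow {1..n}. if S = T then c S * 2 ^ n else 0)"
        using True by (intro sum.cong) (auto simp: walsh_orthogonal)
      also have "\<dots> = c T * 2 ^ n"
        using True by simp
      finally show ?thesis using True by (simp add: cube_expectation_eq)
    next
      case False
      then show ?thesis using c by (auto simp: is_fourier_expansion_def)
    qed
  qed
next
  assume c: "c = ?c"
  have "f x = (\<Sum>S\<in>Pow {1..n}. ?c S * walsh S x)" if x: "x \<in> cube n" for x
  proof -
    have "(\<Sum>S\<in>Pow {1..n}. ?c S * walsh S x)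
        = (\<Sum>S\<in>Pow {1..n}. \<Sum>y\<in>cube n. f y / 2 ^ n * (walsh S y * walsh S x))"
      by (intro sum.cong)
        (auto simp: cube_expectation_eq sum_distrib_left sum_distrib_right sum_divide_distrib mult_ac)
    also have "\<dots> = (\<Sum>y\<in>cube n. f y / 2 ^ n * (\<Sum>S\<in>Pow {1..n}. walsh S y * walsh S x))"
      by (subst sum.swap) (simp add: sum_distrib_left)
    also have "\<dots> = (\<Sum>y\<in>cube n. if y = x then f y else 0)"
      using x by (intro sum.cong refl) (simp add: walsh_completeness del: One_nat_def)
    also have "\<dots> = f x" using x by (simp add: finite_cube)
    finally show ?thesis by simp
  qed
  then show "is_fourier_expansion n f c"
    unfolding is_fourier_expansion_def c by simp
qed

lemma fourier_expansion_ex1: "\<exists>!c. is_fourier_expansion n f c"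
  by (simp add: is_fourier_expansion_iff)

lemma is_fourier_expansion_fourier_coeff: "is_fourier_expansion n f (fourier_coeff n f)"
  unfolding fourier_coeff_def using fourier_expansion_ex1 by (rule theI')

lemma fourier_coeff_eq:
  "S \<subseteq> {1..n} \<Longrightarrow> fourier_coeff n f S = cube_expectation n (\<lambda>x. f x * walsh S x)"
  using is_fourier_expansion_fourier_coeff[of n f] by (simp add: is_fourier_expansion_iff)

end

theory Submission
  imports Defs
begin

text \<open>
  The bound holds pointwise: \<open>(\<Sum>i. \<bar>\<partial>\<^sub>i f x\<bar>) \<le> 4 d\<^sup>3 \<parallel>f\<parallel>\<^sub>\<infinity>\<close> for every \<open>x\<close> in the cube.  Let \<open>A\<close> be the
  set of coordinates where \<open>\<partial>\<^sub>i f x\<close> is positive, and multiply the coordinates of \<open>x\<close> in \<open>A\<close> by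
  \<open>t \<in> [-1, 1]\<close>.  Along this segment the multilinear extension of \<open>f\<close> is a polynomial
  \<open>P t = (\<Sum>S. c S * walsh S x * t ^ card (S \<inter> A))\<close> of degree at most \<open>d\<close>, bounded by \<open>\<parallel>f\<parallel>\<^sub>\<infinity>\<close> because
  the multilinear extension is an average of values of \<open>f\<close>; and \<open>P' 1 = (\<Sum>i\<in>A. \<partial>\<^sub>i f x)\<close>.
  A Markov-type inequality at the endpoint \<open>1\<close> bounds \<open>P' 1\<close>, and the negative derivatives are
  treated in the same way.  For the Markov-type inequality, integrating \<open>P (cos \<theta>)\<close> against the
  kernel \<open>(\<Sum>k=1..d. k\<^sup>2 cos (k \<theta>))\<close> over \<open>[0, \<pi>]\<close> gives \<open>\<pi>/2 * P' 1\<close>.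
\<close>

text \<open>The frequency is an integer because differences such as \<open>j - k\<close> and
  \<open>j - 1\<close> arise below and may be negative.\<close>

lemma has_integral_cos_int_mult:
  fixes m :: int
  shows "((\<lambda>\<theta>. cos (m * \<theta>)) has_integral (if m = 0 then pi else 0)) {0..pi}"
proof (cases "m = 0")
  case True
  then show ?thesis using has_integral_const_real[of "1 :: real" 0 pi] by simp
next
  case False
  have "((\<lambda>\<theta>. cos (m * \<theta>)) has_integral (sin (of_int m * pi) / of_int m - sin (of_int m * 0) / of_int m)) {0..pi}"
    using False
    by (intro fundamental_theorem_of_calculus)
       (auto intro!: derivative_eq_intros simp flip: has_real_derivative_iff_has_vector_derivative)
  then show ?thesis using False by (simp add: mult.commute sin_integer_2pi sin_zero_iff_int2)
qed

lemma has_integral_cos_mult_cos: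
  fixes j :: int and k :: nat
  assumes "k \<ge> 1"
  shows "((\<lambda>\<theta>. cos (j * \<theta>) * cos (k * \<theta>)) has_integral (if \<bar>j\<bar> = int k then pi / 2 else 0)) {0..pi}"
proof -
  have "((\<lambda>\<theta>. (cos ((j - int k) * \<theta>) + cos ((j + int k) * \<theta>)) / 2) has_integral
      ((if j - int k = 0 then pi else 0) + (if j + int k = 0 then pi else 0)) / 2) {0..pi}"
    using has_integral_cos_int_mult[of "j - int k"] has_integral_cos_int_mult[of "j + int k"]
    by (intro has_integral_divide has_integral_add) simp_all
  moreover have "(\<lambda>\<theta>. cos (of_int j * \<theta>) * cos (real k * \<theta>))
      = (\<lambda>\<theta>. (cos (of_int (j - int k) * \<theta>) + cos (of_int (j + int k) * \<theta>)) / 2)"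
    by (simp add: cos_times_cos left_diff_distrib distrib_right)
  \<comment> \<open>Since \<open>k \<ge> 1\<close>, at most one of the frequencies
    \<open>j - k\<close> and \<open>j + k\<close> vanishes, so the value is never
    \<open>pi\<close>.\<close>
  moreover have "((if j - int k = 0 then pi else 0) + (if j + int k = 0 then pi else 0)) / 2
      = (if \<bar>j\<bar> = int k then pi / 2 else 0)"
    using assms by auto
  ultimately show ?thesis by (simp only:)
qed

text \<open>The weight \<open>k\<^sup>2\<close> is the derivative at 1 of the Chebyshev polynomial
  that maps \<open>cos \<theta>\<close> to \<open>cos (k * \<theta>)\<close>.\<close>

definition markov_kernel :: "nat \<Rightarrow> real \<Rightarrow> real" where
  "markov_kernel d \<theta> = (\<Sum>k=1..d. real k ^ 2 * cos (k * \<theta>))"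

lemma has_integral_cos_markov_kernel:
  fixes j :: int
  assumes "\<bar>j\<bar> \<le> int d"
  shows "((\<lambda>\<theta>. cos (j * \<theta>) * markov_kernel d \<theta>) has_integral (pi / 2 * j\<^sup>2)) {0..pi}"
proof -
  have "((\<lambda>\<theta>. \<Sum>k=1..d. real k ^ 2 * (cos (j * \<theta>) * cos (k * \<theta>))) has_integral
      (\<Sum>k=1..d. real k ^ 2 * (if \<bar>j\<bar> = int k then pi / 2 else 0))) {0..pi}"
    by (intro has_integral_sum has_integral_mult_right has_integral_cos_mult_cos) auto
  moreover have "(\<Sum>k=1..d. real k ^ 2 * (if \<bar>j\<bar> = int k then pi / 2 else 0))
      = (\<Sum>k=1..d. if k = nat \<bar>j\<bar> then pi / 2 * j\<^sup>2 else 0)"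
    by (intro sum.cong) (auto simp flip: of_int_power)
  \<comment> \<open>For \<open>j = 0\<close> no index in \<open>{1..d}\<close> matches, and both
    sides are 0.\<close>
  moreover have "\<dots> = pi / 2 * j\<^sup>2"
    using assms by (auto simp: sum.delta)
  moreover have "cos (of_int j * \<theta>) * markov_kernel d \<theta>
      = (\<Sum>k=1..d. real k ^ 2 * (cos (of_int j * \<theta>) * cos (real k * \<theta>)))" for \<theta>
    by (simp add: markov_kernel_def sum_distrib_left mult_ac)
  ultimately show ?thesis by (simp only:)
qed

text \<open>The extra factor \<open>cos (j * \<theta>)\<close> makes the induction work: a factor
  \<open>cos \<theta>\<close> replaces \<open>j\<close> by the average over \<open>j + 1\<close> and
  \<open>j - 1\<close>, and the average of their squares is \<open>j\<^sup>2 + 1\<close>. At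
  \<open>j = 0\<close> the value is \<open>pi / 2\<close> times the derivative of
  \<open>t ^ m\<close> at 1.\<close>

lemma has_integral_cos_power_markov_kernel:
  fixes j :: int
  assumes "int m + \<bar>j\<bar> \<le> int d"
  shows "((\<lambda>\<theta>. cos \<theta> ^ m * cos (j * \<theta>) * markov_kernel d \<theta>) has_integral
    (pi / 2 * (m + j\<^sup>2))) {0..pi}"
  using assms
proof (induction m arbitrary: j)
  case 0
  then show ?case using has_integral_cos_markov_kernel[of j d] by simp
next
  case (Suc m)
  have "((\<lambda>\<theta>. (cos \<theta> ^ m * cos ((j + 1 :: int) * \<theta>) * markov_kernel d \<theta>
        + cos \<theta> ^ m * cos ((j - 1 :: int) * \<theta>) * markov_kernel d \<theta>) / 2) has_integral
      (pi / 2 * (m + (j + 1 :: int)\<^sup>2) + pi / 2 * (m + (j - 1 :: int)\<^sup>2)) / 2) {0..pi}"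
    using Suc.prems by (intro has_integral_divide has_integral_add Suc.IH) auto
  moreover have "cos \<theta> ^ Suc m * cos (of_int j * \<theta>) * markov_kernel d \<theta>
      = (cos \<theta> ^ m * cos (of_int (j + 1) * \<theta>) * markov_kernel d \<theta>
        + cos \<theta> ^ m * cos (of_int (j - 1) * \<theta>) * markov_kernel d \<theta>) / 2" for \<theta>
    by (simp add: distrib_right left_diff_distrib cos_add cos_diff field_simps)
  moreover have "(pi / 2 * (m + (j + 1 :: int)\<^sup>2) + pi / 2 * (m + (j - 1 :: int)\<^sup>2)) / 2
      = pi / 2 * (Suc m + j\<^sup>2)"
    by (simp add: power2_eq_square field_simps)
  ultimately show ?case by (simp only:)
qed

lemma abs_markov_kernel_le: "\<bar>markov_kernel d \<theta>\<bar> \<le> real d ^ 3"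
proof -
  have "\<bar>markov_kernel d \<theta>\<bar> \<le> (\<Sum>k=1..d. real d ^ 2)"
    unfolding markov_kernel_def
  proof (intro order.trans[OF sum_abs] sum_mono)
    fix k assume "k \<in> {1..d}"
    then have "real k ^ 2 * \<bar>cos (k * \<theta>)\<bar> \<le> real d ^ 2 * 1"
      by (intro mult_mono power_mono) auto
    then show "\<bar>real k ^ 2 * cos (k * \<theta>)\<bar> \<le> real d ^ 2" by (simp add: abs_mult)
  qed
  then show ?thesis by (simp add: power2_eq_square power3_eq_cube)
qed

text \<open>The polynomial is an indexed sum of monomials, exponents possibly repeated, so that
  \<open>I\<close> can later be a family of sets \<open>S\<close> with exponent
  \<open>card (S \<inter> A)\<close>. The integral is at most \<open>pi * M * d ^ 3\<close> in
  absolute value; dividing by \<open>pi / 2\<close> gives the constant 2.\<close>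

lemma markov_endpoint_bound:
  fixes w :: "'a \<Rightarrow> real" and e :: "'a \<Rightarrow> nat"
  assumes "finite I" and deg: "\<And>i. i \<in> I \<Longrightarrow> e i \<le> d"
    and bound: "\<And>t. \<bar>t\<bar> \<le> 1 \<Longrightarrow> \<bar>\<Sum>i\<in>I. w i * t ^ e i\<bar> \<le> M"
  shows "\<bar>\<Sum>i\<in>I. w i * e i\<bar> \<le> 2 * real d ^ 3 * M"
proof -
  have M: "M \<ge> 0" using bound[of 0] by linarith
  have "((\<lambda>\<theta>. \<Sum>i\<in>I. w i * (cos \<theta> ^ e i * cos ((0::int) * \<theta>) * markov_kernel d \<theta>)) has_integral
      (\<Sum>i\<in>I. w i * (pi / 2 * (e i + (0::int)\<^sup>2)))) {0..pi}"
    using assms(1) deg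
    by (intro has_integral_sum has_integral_mult_right has_integral_cos_power_markov_kernel) auto
  then have "((\<lambda>\<theta>. (\<Sum>i\<in>I. w i * cos \<theta> ^ e i) * markov_kernel d \<theta>) has_integral
      (pi / 2 * (\<Sum>i\<in>I. w i * e i))) {0..pi}"
    by (simp add: sum_distrib_left sum_distrib_right mult_ac)
  moreover have "norm ((\<Sum>i\<in>I. w i * cos \<theta> ^ e i) * markov_kernel d \<theta>) \<le> M * real d ^ 3" for \<theta>
    using bound[of "cos \<theta>"] abs_markov_kernel_le[of d \<theta>] M
    by (simp add: abs_mult mult_mono)
  ultimately have "norm (pi / 2 * (\<Sum>i\<in>I. w i * e i)) \<le> M * real d ^ 3 * Henstock_Kurzweil_Integration.content (cbox 0 pi)"
    using M by (intro has_integral_bound) auto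
  then have "pi * \<bar>\<Sum>i\<in>I. w i * e i\<bar> \<le> pi * (2 * real d ^ 3 * M)"
    by (simp add: abs_mult mult_ac)
  then show ?thesis by simp
qed

lemma walsh_flip:
  assumes "finite S"
  shows "walsh S (flip i x) = (if i \<in> S then - walsh S x else walsh S x)"
proof (cases "i \<in> S")
  case True
  have "prod (flip i x) (S - {i}) = prod x (S - {i})"
    by (intro prod.cong) (auto simp: flip_def)
  then show ?thesis
    using True assms by (simp add: walsh_def prod.remove[of S i] flip_def)
next
  case False
  then have "prod (flip i x) S = prod x S"
    by (intro prod.cong) (auto simp: flip_def)
  then show ?thesis using False by (simp add: walsh_def)
qed

text \<open>Scaling one coordinate of \<open>x\<close> by \<open>t\<close> averages the values at
  \<open>x\<close> and \<open>flip i x\<close> with weights \<open>(1 + t) / 2\<close> and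
  \<open>(1 - t) / 2\<close>, nonnegative for \<open>\<bar>t\<bar> \<le> 1\<close>. The induction
  keeps \<open>x\<close> arbitrary to reach \<open>flip i x\<close>.\<close>

lemma abs_partial_scaling_le:
  fixes c :: "nat set \<Rightarrow> real"
  assumes "finite A" "A \<subseteq> {1..n}" and I: "\<And>S. S \<in> I \<Longrightarrow> finite S"
    and t: "\<bar>t\<bar> \<le> 1"
    and bound: "\<And>x. x \<in> cube n \<Longrightarrow> \<bar>\<Sum>S\<in>I. c S * walsh S x\<bar> \<le> M"
    and x: "x \<in> cube n"
  shows "\<bar>\<Sum>S\<in>I. c S * walsh S x * t ^ card (S \<inter> A)\<bar> \<le> M"
  using assms(1,2) x
proof (induction A arbitrary: x)
  case empty
  then show ?case using bound by simp
next
  case (insert i A)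
  let ?G = "\<lambda>x. \<Sum>S\<in>I. c S * walsh S x * t ^ card (S \<inter> A)"
  have "c S * walsh S x * t ^ card (S \<inter> insert i A)
      = (1 + t) / 2 * (c S * walsh S x * t ^ card (S \<inter> A))
        + (1 - t) / 2 * (c S * walsh S (flip i x) * t ^ card (S \<inter> A))" if "S \<in> I" for S
    using I[OF that] insert.hyps by (simp add: walsh_flip Int_insert_right field_simps)
  then have "(\<Sum>S\<in>I. c S * walsh S x * t ^ card (S \<inter> insert i A))
      = (1 + t) / 2 * ?G x + (1 - t) / 2 * ?G (flip i x)"
    by (simp add: sum_distrib_left sum.distrib)
  also have "\<bar>\<dots>\<bar> \<le> (1 + t) / 2 * \<bar>?G x\<bar> + (1 - t) / 2 * \<bar>?G (flip i x)\<bar>"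
    using t by (intro order.trans[OF abs_triangle_ineq]) (simp add: abs_mult)
  also have "\<dots> \<le> (1 + t) / 2 * M + (1 - t) / 2 * M"
    using t insert.prems insert.IH flip_in_cube[of x n i]
    by (intro add_mono mult_left_mono) auto
  also have "\<dots> = M" by (simp add: field_simps)
  finally show ?case .
qed

lemma abs_le_sup_norm: "x \<in> cube n \<Longrightarrow> \<bar>f x\<bar> \<le> sup_norm n f"
  by (simp add: sup_norm_def finite_cube)

lemma fourier_expansion_le_degree:
  assumes "x \<in> cube n"
  shows "f x = (\<Sum>S | S \<subseteq> {1..n} \<and> card S \<le> fourier_degree n f. fourier_coeff n f S * walsh S x)"
proof -
  have "fourier_coeff n f S = 0" if "S \<subseteq> {1..n}" "\<not> card S \<le> fourier_degree n f" for S
    using that unfolding fourier_degree_def by (auto intro!: Max_ge)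
  moreover have "f x = (\<Sum>S\<in>Pow {1..n}. fourier_coeff n f S * walsh S x)"
    using is_fourier_expansion_fourier_coeff[of n f] assms by (simp add: is_fourier_expansion_def)
  ultimately show ?thesis
    by (simp only:) (intro sum.mono_neutral_right, auto)
qed

lemma abs_sum_discrete_deriv_le:
  assumes x: "x \<in> cube n" and A: "A \<subseteq> {1..n}"
  shows "\<bar>\<Sum>i\<in>A. discrete_deriv i f x\<bar> \<le> 2 * real (fourier_degree n f) ^ 3 * sup_norm n f"
proof -
  define d where "d = fourier_degree n f"
  define I where "I = {S. S \<subseteq> {1..n} \<and> card S \<le> d}"
  define c where "c = fourier_coeff n f"
  have fin: "finite I" "finite A" "\<And>S. S \<in> I \<Longrightarrow> finite S"
    using A by (auto simp: I_def intro: finite_subset)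
  have f: "f y = (\<Sum>S\<in>I. c S * walsh S y)" if "y \<in> cube n" for y
    using fourier_expansion_le_degree[OF that] by (simp add: I_def c_def d_def)
  have "discrete_deriv i f x = (\<Sum>S\<in>I. c S * walsh S x * (if i \<in> S then 1 else 0))"
    if "i \<in> A" for i
  proof -
    have "discrete_deriv i f x = (\<Sum>S\<in>I. (c S * walsh S x - c S * walsh S (flip i x)) / 2)"
      using f[OF x] f[OF flip_in_cube[OF x, of i]] that A
      by (auto simp: discrete_deriv_def sum_subtractf simp flip: sum_divide_distrib)
    also have "\<dots> = (\<Sum>S\<in>I. c S * walsh S x * (if i \<in> S then 1 else 0))"
      using fin by (intro sum.cong) (auto simp: walsh_flip)
    finally show ?thesis .
  qed
  then have "(\<Sum>i\<in>A. discrete_deriv i f x)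
      = (\<Sum>i\<in>A. \<Sum>S\<in>I. c S * walsh S x * (if i \<in> S then 1 else 0))"
    by (rule sum.cong[OF refl])
  \<comment> \<open>After swapping the sums, each \<open>S\<close> is counted once for every
    \<open>i\<close> in \<open>S \<inter> A\<close>; this is the derivative at \<open>t = 1\<close>
    of the scaled expansion.\<close>
  also have "\<dots> = (\<Sum>S\<in>I. c S * walsh S x * card (S \<inter> A))"
    using fin(2) by (subst sum.swap) (simp add: sum.If_cases Int_commute flip: sum_distrib_left)
  also have "\<bar>\<dots>\<bar> \<le> 2 * real d ^ 3 * sup_norm n f"
  proof (rule markov_endpoint_bound[OF fin(1)])
    fix S assume "S \<in> I"
    then show "card (S \<inter> A) \<le> d"
      using card_mono[of S "S \<inter> A"] fin(3)[of S] by (auto simp: I_def)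
  next
    fix t :: real assume "\<bar>t\<bar> \<le> 1"
    then show "\<bar>\<Sum>S\<in>I. c S * walsh S x * t ^ card (S \<inter> A)\<bar> \<le> sup_norm n f"
      using fin A x f abs_le_sup_norm[of _ n f] by (intro abs_partial_scaling_le) auto
  qed
  finally show ?thesis by (simp add: d_def)
qed

lemma sum_abs_discrete_deriv_le:
  assumes x: "x \<in> cube n"
  shows "(\<Sum>i=1..n. \<bar>discrete_deriv i f x\<bar>) \<le> 4 * real (fourier_degree n f) ^ 3 * sup_norm n f"
proof -
  let ?D = "\<lambda>i. discrete_deriv i f x"
  \<comment> \<open>The bound for arbitrary \<open>A\<close> is applied to both sign classes, whence
    4 = 2 + 2; zero derivatives fall into \<open>?N\<close> and contribute nothing.\<close>
  let ?P = "{i \<in> {1..n}. ?D i > 0}" and ?N = "{i \<in> {1..n}. \<not> ?D i > 0}"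
  have "(\<Sum>i=1..n. \<bar>?D i\<bar>) = (\<Sum>i\<in>?P. \<bar>?D i\<bar>) + (\<Sum>i\<in>?N. \<bar>?D i\<bar>)"
    by (subst sum.union_disjoint[symmetric]) (auto intro!: sum.cong)
  also have "\<dots> = sum ?D ?P - sum ?D ?N"
    by (simp add: sum_negf[symmetric] flip: add_uminus_conv_diff)
  also have "\<dots> \<le> \<bar>sum ?D ?P\<bar> + \<bar>sum ?D ?N\<bar>" by linarith
  also have "\<dots> \<le> 4 * real (fourier_degree n f) ^ 3 * sup_norm n f"
    using abs_sum_discrete_deriv_le[OF x Collect_restrict[of _ "\<lambda>i. ?D i > 0"], of f]
      abs_sum_discrete_deriv_le[OF x Collect_restrict[of _ "\<lambda>i. \<not> ?D i > 0"], of f] by linarith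
  finally show ?thesis .
qed

lemma total_L1_influence_le:
  "total_L1_influence n f \<le> 4 * real (fourier_degree n f) ^ 3 * sup_norm n f"
proof -
  have "total_L1_influence n f = (\<Sum>x\<in>cube n. \<Sum>i=1..n. \<bar>discrete_deriv i f x\<bar>) / 2 ^ n"
    unfolding total_L1_influence_def L1_influence_def L1_norm_def cube_expectation_eq
    by (subst sum.swap) (simp add: sum_divide_distrib)
  also have "\<dots> \<le> (\<Sum>x\<in>cube n. 4 * real (fourier_degree n f) ^ 3 * sup_norm n f) / 2 ^ n"
    by (intro divide_right_mono sum_mono sum_abs_discrete_deriv_le) auto
  also have "\<dots> = 4 * real (fourier_degree n f) ^ 3 * sup_norm n f"
    by (simp add: card_cube)
  finally show ?thesis .
qed

theorem theorem1p2:
  shows "\<exists>C::real. C > 0 \<and>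
    (\<forall>(n::nat) (f :: (nat \<Rightarrow> real) \<Rightarrow> real) (d::nat).
       n \<ge> 1 \<longrightarrow> fourier_degree n f = d \<longrightarrow>
       total_L1_influence n f \<le> C * real d ^ 3 * sup_norm n f)"
  by (intro exI[of _ 4] conjI allI impI) (use total_L1_influence_le in auto)

end
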